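(* Let $n$ be a positive integer coprime to $4$ (i.e. $n$ is odd). Then, with $x=t+t^{-1}$, the Alexander polynomial of the torus knot $T(n,4)$ is expressed as a sum of Chebyshev polynomials of the second kind by $$\Delta_{n,4}(t)=\sum_{j=1}^{\frac{3n-1}{2}}(-1)^{[j/2]}\,V_{\frac{3n-1}{2}-j}(x)+\sum_{i=1}^{\frac{n-1}{2}}(-1)^{[i/2]}\,V_{\frac{n-1}{2}-i}(x)=\widetilde V_{\frac{3n-3}{2}}(x)+\widetilde V_{\frac{n-3}{2}}(x).$$ Equivalently, the coordinates of $\Delta_{n,4}(t)$ in the $\widetilde V$-basis are $\left(\frac{3n-3}{2};\ \frac{n-3}{2}\right)_{\widetilde V}$.
   Context: For coprime positive integers $n,l$, $\Delta_{n,l}(t)$ denotes the Alexander polynomial of the torus knot $T(n,l)$, normalized by the skein relation $\Delta_{+}(t)=(t^{1/2}-t^{-1/2})\Delta_{O}(t)+\Delta_{-}(t)$ together with $\Delta_{\rm unknot}=1$. It is the Laurent polynomial in $t$ given by the known formula $$\Delta_{n,l}(t)=\frac{(t^{nl/2}-t^{-nl/2})(t^{1/2}-t^{-1/2})}{(t^{n/2}-t^{-n/2})(t^{l/2}-t^{-l/2})};$$ for odd $n$, $\Delta_{n,4}(t)=\dfrac{t^{3n/2}+t^{n/2}+t^{-n/2}+t^{-3n/2}}{t^{3/2}+t^{1/2}+t^{-1/2}+t^{-3/2}}$. The monic Chebyshev polynomials of the second kind $V_k(x)$ are defined by $V_0=1$, $V_1=x$, $V_{k+1}=xV_k-V_{k-1}$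 (equivalently $V_k(x)=\sin((k+1)\theta)/\sin\theta$ with $2\cos\theta=x$). For $k\ge 0$, $$\widetilde V_k(x)=\sum_{j=1}^{k+1}(-1)^{[j/2]}\,V_{k+1-j}(x)=V_k-V_{k-1}-V_{k-2}+V_{k-3}+V_{k-4}-\cdots,$$ and $\widetilde V_{-1}=0$ (empty sum). Here $[y]$ is the integer part of $y$. The notation $(a;b)_{\widetilde V}$ stands for the element $\widetilde V_a+\widetilde V_b$. Empty sums are $0$. *)

theory Defs
  imports "HOL-Computational_Algebra.Formal_Laurent_Series"
begin

text \<open>
  Identities between Laurent polynomials in \<open>t^(1/2)\<close> are stated in the field of formal
  Laurent series over \<open>rat\<close> whose indeterminate is \<open>t^(1/2)\<close>, so that quotients of Laurent
  polynomials are genuine quotients and \<open>t^(m/2)\<close> is \<open>t_half powi m\<close> for every integer \<open>m\<close>.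
\<close>

definition t_half :: "rat fls" where
  "t_half = fls_X"

definition t_var :: "rat fls" where
  "t_var = t_half ^ 2"

text \<open>
  The Alexander polynomial of the torus knot \<open>T(n, l)\<close>, for coprime positive \<open>n\<close> and \<open>l\<close>, in
  the normalization given by the skein relation
  \<open>\<Delta>_+ = (t^(1/2) - t^(-1/2)) \<Delta>_O + \<Delta>_-\<close> and \<open>\<Delta> = 1\<close> for the unknot. It is introduced by its
  classical closed formula, not through knot diagrams.
\<close>

definition torus_alexander :: "nat \<Rightarrow> nat \<Rightarrow> rat fls" where
  "torus_alexander n l =
     ((t_half powi (int n * int l) - t_half powi (- (int n * int l))) *
      (t_half powi 1 - t_half powi (- 1))) /
     ((t_half powi int n - t_half powi (- int n)) *
      (t_half powi int l - t_half powi (- int l)))"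

fun cheb_V :: "nat \<Rightarrow> 'a :: comm_ring_1 poly" where
  "cheb_V 0 = 1"
| "cheb_V (Suc 0) = [:0, 1:]"
| "cheb_V (Suc (Suc k)) = [:0, 1:] * cheb_V (Suc k) - cheb_V k"

text \<open>
  The index is an integer because \<open>cheb_V_tilde (-1)\<close> occurs: it is an empty sum, hence \<open>0\<close>.
  Within the range of summation all arguments of \<open>nat\<close> are nonnegative.
\<close>

definition cheb_V_tilde :: "int \<Rightarrow> 'a :: comm_ring_1 poly" where
  "cheb_V_tilde k = (\<Sum>j = 1..k + 1. (- 1) ^ nat (j div 2) * cheb_V (nat (k + 1 - j)))"

text \<open>The element written \<open>(a; b)\<close> with index \<open>V\<close>-tilde.\<close>

definition V_tilde_coords :: "int \<Rightarrow> int \<Rightarrow> 'a :: comm_ring_1 poly" where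
  "V_tilde_coords a b = cheb_V_tilde a + cheb_V_tilde b"

end

theory Submission
  imports Defs
begin

text \<open>
  Write \<open>t = s\<^sup>2\<close> and \<open>S\<^sub>m = cheb_V_tilde (m - 1)\<close>. The signs \<open>+, -, -, +, +, \<dots>\<close> in \<open>S\<^sub>m\<close> change
  whenever the summation index is shifted by two, so \<open>S\<^sub>m\<^sub>+\<^sub>2 + S\<^sub>m\<close> collapses to
  \<open>V\<^sub>m\<^sub>+\<^sub>1 - V\<^sub>m\<close>, and at \<open>x = s\<^sup>2 + s\<^sup>-\<^sup>2\<close> this difference is
  \<open>(s\<^bsup>2m+3\<^esup> + s\<^bsup>-(2m+3)\<^esup>) / (s + s\<^sup>-\<^sup>1)\<close>. Solving the recurrence gives
  \<open>(s + s\<^sup>-\<^sup>1) (s\<^sup>2 + s\<^sup>-\<^sup>2) S\<^sub>m = s\<^bsup>2m+1\<^esup> + s\<^bsup>-(2m+1)\<^esup> \<plusminus> (s + s\<^sup>-\<^sup>1)\<close>,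
  where the first part is a particular solution and the correction, with sign pattern
  \<open>-, +, +, -\<close> of period four in \<open>m\<close>, is the homogeneous one that makes \<open>S\<^sub>0 = 0\<close> and
  \<open>S\<^sub>1 = 1\<close> (\<open>cheb_V_tilde_closed_form\<close>).

  For \<open>n = 2k + 1\<close> the two summands of the theorem are \<open>S\<^sub>m\<close> for \<open>m = 3k + 1\<close> and \<open>m = k\<close>. Their
  corrections are opposite, and what remains is
  \<open>s\<^bsup>3n\<^esup> + s\<^bsup>n\<^esup> + s\<^bsup>-n\<^esup> + s\<^bsup>-3n\<^esup> = (s\<^bsup>4n\<^esup> - s\<^bsup>-4n\<^esup>) / (s\<^bsup>n\<^esup> - s\<^bsup>-n\<^esup>)\<close> over the same expression with
  \<open>n = 1\<close>, which is the Alexander polynomial.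
\<close>

lemma cheb_V_tilde_nat_sum:
  "cheb_V_tilde (int m - 1) = (\<Sum>j = 1..m. (- 1) ^ (j div 2) * cheb_V (m - j))"
proof -
  have "cheb_V_tilde (int m - 1) = (\<Sum>j \<in> int ` {1..m}. (- 1) ^ nat (j div 2) * cheb_V (nat (int m - j)))"
    by (simp add: cheb_V_tilde_def image_int_atLeastAtMost)
  also have "\<dots> = (\<Sum>j = 1..m. (- 1) ^ nat (int j div 2) * cheb_V (nat (int m - int j)))"
    by (subst sum.reindex) auto
  also have "\<dots> = (\<Sum>j = 1..m. (- 1) ^ (j div 2) * cheb_V (m - j))"
    by (intro sum.cong) (auto simp: nat_div_distrib simp flip: of_nat_diff)
  finally show ?thesis .
qed

text \<open>
  Shifting the index of summation by two flips every sign, so all but the two leading terms cancel.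
\<close>

lemma cheb_V_tilde_add_two:
  "cheb_V_tilde (int (m + 2) - 1) + cheb_V_tilde (int m - 1) =
   (cheb_V (Suc m) - cheb_V m :: 'a :: comm_ring_1 poly)"
proof -
  let ?f = "\<lambda>j. (- 1) ^ (j div 2) * cheb_V (m + 2 - j) :: 'a poly"
  have "cheb_V_tilde (int (m + 2) - 1) = (\<Sum>j = 1..m + 2. ?f j)"
    by (rule cheb_V_tilde_nat_sum)
  also have "\<dots> = ?f 1 + (?f 2 + (\<Sum>j = 1 + 2..m + 2. ?f j))"
  proof -
    have "{1..m + 2} = insert 1 (insert 2 {1 + 2..m + 2})"
      by auto
    then show ?thesis by (simp only:) simp
  qed
  also have "(\<Sum>j = 1 + 2..m + 2. ?f j) = (\<Sum>j = 1..m. ?f (j + 2))"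
    by (rule sum.shift_bounds_cl_nat_ivl)
  also have "\<dots> = - cheb_V_tilde (int m - 1)"
    unfolding cheb_V_tilde_nat_sum by (simp flip: sum_negf)
  finally show ?thesis by simp
qed

lemma power_sum_recurrence:
  fixes s r :: "'a :: idom"
  assumes "s * r = 1"
  shows "(s^2 + r^2) * (s ^ (p + 2) + r ^ (p + 2)) = s ^ (p + 4) + r ^ (p + 4) + (s ^ p + r ^ p)"
proof -
  have "(s^2 + r^2) * (a * s^2 + b * r^2) = a * s^4 + b * r^4 + (a + b)" for a b
    using assms by algebra
  then show ?thesis
    unfolding power_add .
qed

text \<open>
  Both sides satisfy the recurrence \<open>a\<^sub>m\<^sub>+\<^sub>2 = (s\<^sup>2 + r\<^sup>2) a\<^sub>m\<^sub>+\<^sub>1 - a\<^sub>m\<close>. This is the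
  product formula for \<open>sin ((m + 2) \<theta>) - sin ((m + 1) \<theta>)\<close> in exponential form.
\<close>

lemma cheb_V_diff_closed_form:
  fixes s r :: "'a :: idom"
  assumes "s * r = 1"
  shows "(s + r) * (poly (cheb_V (Suc m)) (s^2 + r^2) - poly (cheb_V m) (s^2 + r^2)) =
         s ^ (2 * m + 3) + r ^ (2 * m + 3)"
proof (induction m rule: cheb_V.induct)
  case 1
  show ?case using assms by simp algebra
next
  case 2
  show ?case using assms by (simp add: eval_nat_numeral) algebra
next
  case (3 k)
  let ?V = "\<lambda>k. poly (cheb_V k) (s^2 + r^2)"
  have "(s + r) * (?V (Suc (Suc (Suc k))) - ?V (Suc (Suc k))) =
        (s^2 + r^2) * ((s + r) * (?V (Suc (Suc k)) - ?V (Suc k))) -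
        (s + r) * (?V (Suc k) - ?V k)"
    by (simp add: algebra_simps)
  also have "\<dots> = (s^2 + r^2) * (s ^ (2 * Suc k + 3) + r ^ (2 * Suc k + 3)) -
                  (s ^ (2 * k + 3) + r ^ (2 * k + 3))"
    using 3 by simp
  also have "\<dots> = s ^ (2 * Suc (Suc k) + 3) + r ^ (2 * Suc (Suc k) + 3)"
    using power_sum_recurrence[OF assms, of "2 * k + 3"]
    by (simp add: add.commute add_diff_eq diff_eq_eq)
  finally show ?case .
qed

text \<open>
  After multiplication by \<open>(s + r) (s\<^sup>2 + r\<^sup>2)\<close> the powers of \<open>s\<close> and \<open>r\<close> form a particular
  solution of the recurrence \<open>cheb_V_tilde_add_two\<close>, and the signed term is the solution of \<open>a\<^sub>m\<^sub>+\<^sub>2 + a\<^sub>m = 0\<close> that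
  adjusts the initial values.
\<close>

lemma cheb_V_tilde_closed_form:
  fixes s r :: "'a :: idom"
  assumes "s * r = 1"
  shows "(s + r) * (s^2 + r^2) * poly (cheb_V_tilde (int m - 1)) (s^2 + r^2) =
         s ^ (2 * m + 1) + r ^ (2 * m + 1) - (- 1) ^ ((m + 1) div 2) * (s + r)"
proof (induction m rule: induct_nat_012)
  case 0
  show ?case by (simp add: cheb_V_tilde_def)
next
  case 1
  show ?case using assms by (simp add: cheb_V_tilde_def eval_nat_numeral) algebra
next
  case (ge2 m)
  let ?S = "\<lambda>m. poly (cheb_V_tilde (int m - 1)) (s^2 + r^2)"
  let ?V = "\<lambda>k. poly (cheb_V k) (s^2 + r^2)"
  let ?e = "(- 1) ^ ((m + 1) div 2) :: 'a"
  have "?S (m + 2) + ?S m = ?V (Suc m) - ?V m"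
    using arg_cong[OF cheb_V_tilde_add_two[of m], of "\<lambda>p. poly p (s^2 + r^2)"]
    by (simp only: poly_add poly_diff)
  then have "(s + r) * (s^2 + r^2) * ?S (m + 2) =
        (s^2 + r^2) * ((s + r) * (?V (Suc m) - ?V m)) - (s + r) * (s^2 + r^2) * ?S m"
    by algebra
  also have "\<dots> = (s^2 + r^2) * (s ^ (2 * m + 3) + r ^ (2 * m + 3)) -
                  (s ^ (2 * m + 1) + r ^ (2 * m + 1) - ?e * (s + r))"
    by (simp only: cheb_V_diff_closed_form[OF assms] ge2)
  also have "\<dots> = s ^ (2 * m + 5) + r ^ (2 * m + 5) + ?e * (s + r)"
  proof -
    have "2 * m + 3 = 2 * m + 1 + 2" "2 * m + 5 = 2 * m + 1 + 4"
      by simp_all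
    then show ?thesis
      by (simp only: power_sum_recurrence[OF assms]) simp
  qed
  also have "\<dots> = s ^ (2 * (m + 2) + 1) + r ^ (2 * (m + 2) + 1) -
                  (- 1) ^ ((m + 2 + 1) div 2) * (s + r)"
  proof -
    have "2 * m + 5 = 2 * (m + 2) + 1" "(m + 2 + 1) div 2 = Suc ((m + 1) div 2)"
      by simp_all
    then show ?thesis
      by (metis (no_types) diff_minus_eq_add mult_minus1 mult_minus_left power_Suc)
  qed
  finally show ?case by (simp only: add_2_eq_Suc')
qed

text \<open>
  The sign \<open>(-1)\<^bsup>(m + 1) div 2\<^esup>\<close> has period four in \<open>m\<close> with pattern \<open>+, -, -, +\<close>, so it is reversed
  by \<open>m \<mapsto> 1 - m\<close>, and \<open>3k + 1\<close> is congruent to \<open>1 - k\<close> modulo four.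
\<close>

lemma minus_one_power_half_cancel:
  "(- 1) ^ ((3 * k + 1 + 1) div 2) + (- 1) ^ ((k + 1) div 2) = (0 :: 'a :: comm_ring_1)"
proof -
  have "(3 * k + 1 + 1) div 2 = k + (k + 2) div 2"
    by simp
  moreover have "even (k + (k + 2) div 2) \<longleftrightarrow> odd ((k + 1) div 2)"
    by presburger
  ultimately show ?thesis
    by (auto simp: minus_one_power_iff)
qed

text \<open>
  The polynomial identity behind the theorem, free of division: the geometric sum
  \<open>s\<^bsup>3n\<^esup> + s\<^bsup>n\<^esup> + r\<^bsup>n\<^esup> + r\<^bsup>3n\<^esup>\<close>, left once the corrections cancel, telescopes against
  \<open>s\<^bsup>n\<^esup> - r\<^bsup>n\<^esup>\<close>, and likewise \<open>(s + r) (s\<^sup>2 + r\<^sup>2)\<close> against \<open>s - r\<close>.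
\<close>

lemma cheb_V_tilde_sum_closed_form:
  fixes s r :: "'a :: idom"
  assumes "s * r = 1" and n: "n = 2 * k + 1"
  shows "(s ^ n - r ^ n) * (s ^ 4 - r ^ 4) *
           (poly (cheb_V_tilde (int (3 * k + 1) - 1)) (s^2 + r^2) +
            poly (cheb_V_tilde (int k - 1)) (s^2 + r^2)) =
         (s ^ (n * 4) - r ^ (n * 4)) * (s - r)"
proof -
  let ?S = "\<lambda>m. poly (cheb_V_tilde (int m - 1)) (s^2 + r^2)"
  let ?e = "\<lambda>m. (- 1) ^ ((m + 1) div 2) :: 'a"
  have exponents: "2 * (3 * k + 1) + 1 = n * 3" "2 * k + 1 = n"
    using n by simp_all
  have "(s + r) * (s^2 + r^2) * (?S (3 * k + 1) + ?S k) =
        s ^ (n * 3) + r ^ (n * 3) + s ^ n + r ^ n - (?e (3 * k + 1) + ?e k) * (s + r)"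
    unfolding distrib_left[of "(s + r) * (s^2 + r^2)"] cheb_V_tilde_closed_form[OF assms(1)] exponents
    by (simp add: algebra_simps)
  also have "\<dots> = (s ^ n)^3 + (r ^ n)^3 + s ^ n + r ^ n"
    by (simp only: minus_one_power_half_cancel power_mult) simp
  finally have sum: "(s + r) * (s^2 + r^2) * (?S (3 * k + 1) + ?S k) = \<dots>" .
  have "(s ^ n - r ^ n) * (s ^ 4 - r ^ 4) * (?S (3 * k + 1) + ?S k) =
        (s ^ n - r ^ n) * (s - r) * ((s + r) * (s^2 + r^2) * (?S (3 * k + 1) + ?S k))"
    by algebra
  also have "\<dots> = (s ^ n - r ^ n) * (s - r) * ((s ^ n)^3 + (r ^ n)^3 + s ^ n + r ^ n)"
    by (simp only: sum)
  also have "\<dots> = ((s ^ n)^4 - (r ^ n)^4) * (s - r)"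
  proof -
    have "(a - b) * c * (a^3 + b^3 + a + b) = (a^4 - b^4) * c" if "a * b = 1" for a b c :: 'a
      using that by algebra
    moreover have "s ^ n * r ^ n = 1"
      using assms(1) by (simp flip: power_mult_distrib)
    ultimately show ?thesis by blast
  qed
  finally show ?thesis
    by (simp only: power_mult)
qed

lemma fls_X_power_neq_inverse:
  assumes "m > 0"
  shows "(fls_X :: 'a :: field fls) ^ m \<noteq> inverse fls_X ^ m"
proof
  assume "(fls_X :: 'a fls) ^ m = inverse fls_X ^ m"
  then have "(fls_X :: 'a fls) ^ (m + m) = fls_X ^ m * inverse fls_X ^ m"
    by (simp only: power_add)
  also have "\<dots> = (fls_X * inverse fls_X) ^ m"
    by (simp only: power_mult_distrib)
  also have "\<dots> = 1"
    by simp
  finally have "(fls_X :: 'a fls) ^ (m + m) = 1" .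
  then have "fls_subdegree ((fls_X :: 'a fls) ^ (m + m)) = 0"
    by simp
  then show False
    using assms by simp
qed

theorem proposition3:
  fixes n :: nat and x :: "rat fls"
  assumes "n > 0" and "coprime n 4" and "x = t_var + inverse t_var"
  shows "torus_alexander n 4 =
           (\<Sum>j = 1..(3 * n - 1) div 2.
              (- 1) ^ (j div 2) * poly (cheb_V ((3 * n - 1) div 2 - j)) x) +
           (\<Sum>i = 1..(n - 1) div 2.
              (- 1) ^ (i div 2) * poly (cheb_V ((n - 1) div 2 - i)) x) \<and>
         torus_alexander n 4 =
           poly (cheb_V_tilde ((3 * int n - 3) div 2)) x +
           poly (cheb_V_tilde ((int n - 3) div 2)) x \<and>
         torus_alexander n 4 =
           poly (V_tilde_coords ((3 * int n - 3) div 2) ((int n - 3) div 2)) x"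
proof -
  have "odd n"
  proof
    assume "even n"
    then have "2 dvd gcd n 4" by simp
    then show False using assms(2) by simp
  qed
  then obtain k where n: "n = 2 * k + 1"
    by (rule oddE)
  have int_indices: "(3 * int n - 3) div 2 = int (3 * k + 1) - 1" "(int n - 3) div 2 = int k - 1"
    and nat_indices: "(3 * n - 1) div 2 = 3 * k + 1" "(n - 1) div 2 = k"
    using n by simp_all
  define s r where "s = t_half" and "r = inverse t_half"
  have sr: "s * r = 1"
    by (simp add: s_def r_def t_half_def)
  have x: "x = s^2 + r^2"
    by (simp add: assms(3) t_var_def s_def r_def power_inverse)
  have denominator: "(s ^ n - r ^ n) * (s ^ 4 - r ^ 4) \<noteq> 0"
    using assms(1) by (simp add: s_def r_def t_half_def fls_X_power_neq_inverse)
  have powi: "t_half powi int m = s ^ m" "t_half powi (- int m) = r ^ m" for m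
    by (simp_all add: s_def r_def power_int_minus power_inverse)
  have "torus_alexander n 4 =
        (s ^ (n * 4) - r ^ (n * 4)) * (s - r) / ((s ^ n - r ^ n) * (s ^ 4 - r ^ 4))"
    using powi[of "n * 4"] powi[of 1] powi[of n] powi[of 4]
    by (simp add: torus_alexander_def)
  also have "\<dots> = poly (cheb_V_tilde (int (3 * k + 1) - 1)) x + poly (cheb_V_tilde (int k - 1)) x"
    unfolding x cheb_V_tilde_sum_closed_form[OF sr n, symmetric]
    using denominator by simp
  finally have alexander: "torus_alexander n 4 = \<dots>" .
  have nat_sum: "(\<Sum>j = 1..m. (- 1) ^ (j div 2) * poly (cheb_V (m - j)) x) =
                 poly (cheb_V_tilde (int m - 1)) x" for m
    unfolding cheb_V_tilde_nat_sum by (simp add: poly_sum)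
  show ?thesis
    unfolding int_indices nat_indices nat_sum V_tilde_coords_def poly_add
    using alexander by blast
qed

end
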